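(* Let $\Gamma:\ell_\infty^+\to\ell_\infty^+$ be a gain operator satisfying the $\oplus$-MBI property with some $\varphi\in\mathcal{K}_\infty$. For each $r>0$, the points $\sigma_*(r)$ and $\sigma^*(r)$ are the minimal and the maximal fixed point of $\Gamma_r$, respectively. That is, both are fixed points of $\Gamma_r$ and any fixed point $s\in\ell_\infty^+$ of $\Gamma_r$ satisfies $\sigma_*(r)\le s\le\sigma^*(r)$. In particular, the order interval $[\sigma_*(r),\sigma^*(r)]:=\{s\in\ell_\infty^+:\sigma_*(r)\le s\le\sigma^*(r)\}$ is an invariant set for $\Gamma_r$ and contains all of its fixed points.
   Context: $\mathbb{N}=\{1,2,\dots\}$, $\mathbb{Z}_+=\{0,1,\dots\}$, $\mathbb{R}_+=[0,\infty)$. $\ell_\infty$ is the Banach space of bounded real sequences with sup norm $\|\cdot\|_\infty$; $\ell_\infty^+$ is the cone of nonnegative sequences; $\le$ is the componentwise order; $\oplus$, $\bigoplus$ denote componentwise max/supremum; $\mathbb{1}$ is the sequence with all components $1$. For $I\subseteq\mathbb{N}$, $\ell_\infty^+(I)=\{s\in\ell_\infty^+: s_i=0\ \forall i\notin I\}$. A set $A$ is invariant for $T$ if $T(A)\subseteq A$. $\mathcal{K}$: continuous strictly increasing $\gamma:\mathbb{R}_+\to\mathbb{R}_+$ with $\gamma(0)=0$; $\mathcal{K}_\infty$: unbounded elements of $\mathcal{K}$. A monotone aggregation function (MAF) is $\mu:\ell_\infty^+\to[0,\infty]$ with $\mu(0)=0$; $s^1\le s^2\Rightarrow\mu(s^1)\le\mu(s^2)$;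 and $\mu$ finite-valued and continuous on $\ell_\infty^+(I)$ for every finite $I\subset\mathbb{N}$. Gain operator: for each $i\in\mathbb{N}$ one is given a finite set $I_i\subset\mathbb{N}\setminus\{i\}$, functions $\gamma_{ij}\in\mathcal{K}\cup\{0\}$ ($j\in\mathbb{N}$) with $\gamma_{ij}=0$ for $j\notin I_i$, and a MAF $\mu_i$; $\Gamma(s)=(\mu_i([\gamma_{ij}(s_j)]_{j\in\mathbb{N}}))_{i\in\mathbb{N}}$. Standing assumption: $\Gamma$ is well-defined (maps $\ell_\infty^+$ into itself) and norm-continuous. $\oplus$-MBI property with $\varphi\in\mathcal{K}_\infty$: for all $s,b\in\ell_\infty^+$, $s\le\Gamma(s)\oplus b\Rightarrow\|s\|_\infty\le\varphi(\|b\|_\infty)$. $\hat\Gamma(s)=s\oplus\Gamma(s)$; $\sigma_*(r):=\bigoplus_{k=0}^\infty\hat\Gamma^k(r\mathbb{1})$; $\Gamma_r(s):=r\mathbb{1}\oplus\Gamma(s)$; $\sigma^*_i(r):=\inf_{n\in\mathbb{Z}_+}\pi_i(\Gamma_r^n(\varphi(r)\mathbb{1}))$ for $i\in\mathbb{N}$, with $\pi_i$ the $i$th coordinate. *)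

theory Defs
  imports "HOL-Analysis.Analysis"
begin

(* The type nat \<Rightarrow>\<^sub>C real is the Banach space of bounded real sequences with the
   sup norm: nat is discrete, so continuity is no restriction. The index set
   {1,2,...} is relabelled as nat = {0,1,...}; index values play no role. *)
type_synonym linf = "nat \<Rightarrow>\<^sub>C real"

definition linf_le :: "linf \<Rightarrow> linf \<Rightarrow> bool" (infix "\<preceq>" 50) where
  "s \<preceq> t \<longleftrightarrow> (\<forall>i. apply_bcontfun s i \<le> apply_bcontfun t i)"

definition linf_pos :: "linf set" where
  "linf_pos = {s. \<forall>i. 0 \<le> apply_bcontfun s i}"

definition linf_pos_on :: "nat set \<Rightarrow> linf set" where
  "linf_pos_on I = {s \<in> linf_pos. \<forall>i. i \<notin> I \<longrightarrow> apply_bcontfun s i = 0}"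

definition linf_max :: "linf \<Rightarrow> linf \<Rightarrow> linf" (infixl "\<oplus>" 65) where
  "s \<oplus> t = Bcontfun (\<lambda>i. max (apply_bcontfun s i) (apply_bcontfun t i))"

(* Componentwise supremum and infimum of a sequence of points; meaningful for
   norm-bounded sequences. *)
definition linf_Sup :: "(nat \<Rightarrow> linf) \<Rightarrow> linf" where
  "linf_Sup x = Bcontfun (\<lambda>i. SUP k. apply_bcontfun (x k) i)"

definition linf_Inf :: "(nat \<Rightarrow> linf) \<Rightarrow> linf" where
  "linf_Inf x = Bcontfun (\<lambda>i. INF k. apply_bcontfun (x k) i)"

definition ones :: linf where
  "ones = const_bcontfun 1"

definition order_interval :: "linf \<Rightarrow> linf \<Rightarrow> linf set" where
  "order_interval a b = {s \<in> linf_pos. a \<preceq> s \<and> s \<preceq> b}"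

lemma bcontfun_nat_iff: "f \<in> bcontfun \<longleftrightarrow> bounded (range f)" for f :: "nat \<Rightarrow> real"
  by (simp add: bcontfun_def)

lemma apply_linf_max:
  "apply_bcontfun (s \<oplus> t) i = max (apply_bcontfun s i) (apply_bcontfun t i)"
proof -
  have "\<bar>max (apply_bcontfun s k) (apply_bcontfun t k)\<bar> \<le> max (norm s) (norm t)" for k
    using norm_bounded[of s k] norm_bounded[of t k] by auto
  then have "(\<lambda>i. max (apply_bcontfun s i) (apply_bcontfun t i)) \<in> bcontfun"
    by (auto simp: bcontfun_nat_iff bounded_iff)
  then show ?thesis
    by (simp add: linf_max_def Bcontfun_inverse)
qed

(* Functions on the half-line [0,\<infinity>) are represented by functions on the reals
   whose values at negative arguments are irrelevant. *)
definition class_K :: "(real \<Rightarrow> real) set" where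
  "class_K = {\<gamma>. \<gamma> ` {0..} \<subseteq> {0..} \<and> continuous_on {0..} \<gamma> \<and>
                  strict_mono_on {0..} \<gamma> \<and> \<gamma> 0 = 0}"

definition class_K_inf :: "(real \<Rightarrow> real) set" where
  "class_K_inf = {\<gamma> \<in> class_K. \<not> bounded (\<gamma> ` {0..})}"

definition MAF :: "(linf \<Rightarrow> ennreal) \<Rightarrow> bool" where
  "MAF \<mu> \<longleftrightarrow>
     \<mu> 0 = 0 \<and>
     (\<forall>s\<in>linf_pos. \<forall>t\<in>linf_pos. s \<preceq> t \<longrightarrow> \<mu> s \<le> \<mu> t) \<and>
     (\<forall>I. finite I \<longrightarrow>
        (\<forall>s\<in>linf_pos_on I. \<mu> s < \<infinity>) \<and> continuous_on (linf_pos_on I) \<mu>)"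

(* The equation ennreal (...) = \<mu> i (...), together with \<Gamma> s \<in> linf_pos, says that
   every \<mu> i (...) is finite and that these values form a bounded sequence, i.e.
   that the operator given by the data is well-defined. The argument of \<mu> i has
   finite support, as \<gamma> i j vanishes for j \<notin> I i. *)
definition gain_operator :: "(linf \<Rightarrow> linf) \<Rightarrow> bool" where
  "gain_operator \<Gamma> \<longleftrightarrow>
     (\<exists>(I :: nat \<Rightarrow> nat set) (\<gamma> :: nat \<Rightarrow> nat \<Rightarrow> real \<Rightarrow> real) (\<mu> :: nat \<Rightarrow> linf \<Rightarrow> ennreal).
        (\<forall>i. finite (I i) \<and> i \<notin> I i) \<and>
        (\<forall>i j. \<gamma> i j \<in> class_K \<or> (\<forall>x\<ge>0. \<gamma> i j x = 0)) \<and>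
        (\<forall>i j. j \<notin> I i \<longrightarrow> (\<forall>x\<ge>0. \<gamma> i j x = 0)) \<and>
        (\<forall>i. MAF (\<mu> i)) \<and>
        (\<forall>s\<in>linf_pos. \<Gamma> s \<in> linf_pos \<and>
           (\<forall>i. ennreal (apply_bcontfun (\<Gamma> s) i) =
                 \<mu> i (Bcontfun (\<lambda>j. \<gamma> i j (apply_bcontfun s j)))))) \<and>
     continuous_on linf_pos \<Gamma>"

definition max_MBI :: "(linf \<Rightarrow> linf) \<Rightarrow> (real \<Rightarrow> real) \<Rightarrow> bool" where
  "max_MBI \<Gamma> \<phi> \<longleftrightarrow>
     (\<forall>s\<in>linf_pos. \<forall>b\<in>linf_pos. s \<preceq> \<Gamma> s \<oplus> b \<longrightarrow> norm s \<le> \<phi> (norm b))"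

definition gain_hat :: "(linf \<Rightarrow> linf) \<Rightarrow> linf \<Rightarrow> linf" where
  "gain_hat \<Gamma> s = s \<oplus> \<Gamma> s"

definition gain_r :: "(linf \<Rightarrow> linf) \<Rightarrow> real \<Rightarrow> linf \<Rightarrow> linf" where
  "gain_r \<Gamma> r s = (r *\<^sub>R ones) \<oplus> \<Gamma> s"

definition sigma_lower :: "(linf \<Rightarrow> linf) \<Rightarrow> real \<Rightarrow> linf" where
  "sigma_lower \<Gamma> r = linf_Sup (\<lambda>k. (gain_hat \<Gamma> ^^ k) (r *\<^sub>R ones))"

definition sigma_upper :: "(linf \<Rightarrow> linf) \<Rightarrow> (real \<Rightarrow> real) \<Rightarrow> real \<Rightarrow> linf" where
  "sigma_upper \<Gamma> \<phi> r = linf_Inf (\<lambda>n. (gain_r \<Gamma> r ^^ n) (\<phi> r *\<^sub>R ones))"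

lemma apply_linf_Sup:
  assumes "bounded (range x)"
  shows "bdd_above (range (\<lambda>k. apply_bcontfun (x k) i))"
    and "apply_bcontfun (linf_Sup x) i = (SUP k. apply_bcontfun (x k) i)"
proof -
  obtain B where B: "norm (x k) \<le> B" for k
    using assms by (auto simp: bounded_iff)
  have b: "\<bar>apply_bcontfun (x k) j\<bar> \<le> B" for k j
    using norm_bounded[of "x k" j] B[of k] by simp
  show bdd: "bdd_above (range (\<lambda>k. apply_bcontfun (x k) i))" for i
    using b by (auto simp: bdd_above_def abs_le_iff)
  have "\<bar>SUP k. apply_bcontfun (x k) j\<bar> \<le> B" for j
    using b by (intro cSup_abs_le) auto
  then have "(\<lambda>i. SUP k. apply_bcontfun (x k) i) \<in> bcontfun"
    by (auto simp: bcontfun_nat_iff bounded_iff)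
  then show "apply_bcontfun (linf_Sup x) i = (SUP k. apply_bcontfun (x k) i)"
    by (simp add: linf_Sup_def Bcontfun_inverse)
qed

(* For nonnegative sequences the infimum needs no boundedness from above. *)
lemma apply_linf_Inf:
  assumes "\<And>k. x k \<in> linf_pos"
  shows "bdd_below (range (\<lambda>k. apply_bcontfun (x k) i))"
    and "apply_bcontfun (linf_Inf x) i = (INF k. apply_bcontfun (x k) i)"
proof -
  have p: "0 \<le> apply_bcontfun (x k) j" for k j
    using assms by (auto simp: linf_pos_def)
  show bdd: "bdd_below (range (\<lambda>k. apply_bcontfun (x k) i))" for i
    using p by (auto simp: bdd_below_def)
  have "0 \<le> (INF k. apply_bcontfun (x k) j)" for j
    using p by (intro cINF_greatest) auto
  moreover have "(INF k. apply_bcontfun (x k) j) \<le> norm (x 0)" for j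
    using cINF_lower[OF bdd[of j], of 0] norm_bounded[of "x 0" j] by simp
  ultimately have "(\<lambda>i. INF k. apply_bcontfun (x k) i) \<in> bcontfun"
    by (auto simp: bcontfun_nat_iff bounded_iff abs_le_iff intro!: exI[of _ "norm (x 0)"])
       (metis add_increasing2 neg_le_0_iff_le norm_ge_zero order_trans)
  then show "apply_bcontfun (linf_Inf x) i = (INF k. apply_bcontfun (x k) i)"
    by (simp add: linf_Inf_def Bcontfun_inverse)
qed

end

theory Submission imports Defs begin

text \<open>
  The operator \<open>\<Gamma>\<close> is monotone, and continuous for coordinatewise convergence because each
  coordinate depends on finitely many arguments. The iterates \<open>s\<^sub>k\<close> of \<open>gain_hat \<Gamma>\<close> from
  \<open>r\<one>\<close> satisfy \<open>s\<^sub>k \<preceq> \<Gamma> s\<^sub>k \<oplus> r\<one>\<close>, so the MBI property bounds them by \<open>\<phi> r\<close>.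

  The iterates \<open>x\<^sub>n\<close> of \<open>gain_r \<Gamma> r\<close> from \<open>\<phi>(r)\<one>\<close> need not decrease. They are bounded
  by \<open>\<phi> (\<phi> r)\<close>, being dominated by the iterates of \<open>gain_hat \<Gamma>\<close> from \<open>\<phi>(r)\<one>\<close>. Their
  coordinatewise limes superior \<open>y\<close> satisfies \<open>y \<preceq> gain_r \<Gamma> r y\<close>, hence
  \<open>y \<preceq> \<phi>(r)\<one>\<close> by the MBI property, hence \<open>y \<preceq> x\<^sub>n\<close> for all \<open>n\<close> by monotonicity.
  So \<open>x\<^sub>n\<close> converges coordinatewise to its infimum \<open>y\<close>, which is a fixed point.
\<close>

section \<open>The componentwise order, maxima and multiples of the constant sequence\<close>

lemma linf_le_refl: "s \<preceq> s"
  by (simp add: linf_le_def)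

lemma linf_le_trans: "s \<preceq> t \<Longrightarrow> t \<preceq> u \<Longrightarrow> s \<preceq> u"
  unfolding linf_le_def by (meson order_trans)

lemma linf_le_antisym: "s \<preceq> t \<Longrightarrow> t \<preceq> s \<Longrightarrow> s = t"
  by (auto simp: linf_le_def intro!: bcontfun_eqI antisym)

lemma linf_pos_mono: "s \<in> linf_pos \<Longrightarrow> s \<preceq> t \<Longrightarrow> t \<in> linf_pos"
  unfolding linf_pos_def linf_le_def mem_Collect_eq by (meson order_trans)

lemma linf_pos_max: "s \<in> linf_pos \<Longrightarrow> s \<oplus> t \<in> linf_pos"
  by (auto simp: linf_pos_def apply_linf_max max.coboundedI1)

lemma linf_max_mono: "s \<preceq> s' \<Longrightarrow> t \<preceq> t' \<Longrightarrow> s \<oplus> t \<preceq> s' \<oplus> t'"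
  unfolding linf_le_def apply_linf_max by (blast intro: max.mono)

lemma linf_max_ge: "s \<preceq> s \<oplus> t" "t \<preceq> s \<oplus> t"
  by (auto simp: linf_le_def apply_linf_max)

lemma linf_max_le_iff: "s \<oplus> t \<preceq> u \<longleftrightarrow> s \<preceq> u \<and> t \<preceq> u"
  by (auto simp: linf_le_def apply_linf_max)

lemma linf_max_commute: "s \<oplus> t = t \<oplus> s"
  by (auto intro!: bcontfun_eqI simp: apply_linf_max max.commute)

lemma apply_ones [simp]: "apply_bcontfun ones i = 1"
  by (simp add: ones_def)

lemma apply_scale_ones: "apply_bcontfun (c *\<^sub>R ones) i = c"
  by simp

lemma norm_scale_ones: "norm (c *\<^sub>R ones) = \<bar>c\<bar>"
proof (rule antisym)
  show "norm (c *\<^sub>R ones) \<le> \<bar>c\<bar>"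
    by (rule norm_bound) simp
  show "\<bar>c\<bar> \<le> norm (c *\<^sub>R ones)"
    using norm_bounded[of "c *\<^sub>R ones" 0] by simp
qed

lemma scale_ones_pos: "0 \<le> c \<Longrightarrow> c *\<^sub>R ones \<in> linf_pos"
  by (simp add: linf_pos_def)

text \<open>Links the norm bounds in which the MBI property is phrased to the order bounds on which
  the monotonicity arguments act.\<close>

lemma linf_pos_norm_le_iff:
  "s \<in> linf_pos \<Longrightarrow> norm s \<le> c \<longleftrightarrow> s \<preceq> c *\<^sub>R ones"
proof -
  assume s: "s \<in> linf_pos"
  have "apply_bcontfun s i \<le> norm s" for i
    using norm_bounded[of s i] by simp
  moreover have "norm s \<le> c" if "\<forall>i. apply_bcontfun s i \<le> c"
    using s that by (intro norm_bound) (auto simp: linf_pos_def)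
  ultimately show ?thesis
    unfolding linf_le_def apply_scale_ones by (meson order_trans)
qed

section \<open>Monotonicity and coordinatewise continuity of gain operators\<close>

lemma bcontfun_finite_support:
  fixes f :: "nat \<Rightarrow> real"
  assumes "finite I" and "\<And>j. j \<notin> I \<Longrightarrow> f j = 0"
  shows "f \<in> bcontfun"
proof -
  have "range f \<subseteq> insert 0 (f ` I)"
    using assms(2) by auto
  then show ?thesis
    unfolding bcontfun_nat_iff using assms(1) by (meson finite_imp_bounded finite_imageI finite_insert finite_subset)
qed

text \<open>Outside \<open>I\<close> the difference vanishes, so its sup norm is at most the finite
  sum of the coordinate distances over \<open>I\<close>, and each summand tends to 0.\<close>

lemma tendsto_linf_finite_support:
  fixes f :: "nat \<Rightarrow> linf"
  assumes "finite I"
    and "\<And>n j. j \<notin> I \<Longrightarrow> apply_bcontfun (f n) j = apply_bcontfun g j"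
    and "\<And>j. (\<lambda>n. apply_bcontfun (f n) j) \<longlonglongrightarrow> apply_bcontfun g j"
  shows "f \<longlonglongrightarrow> g"
proof -
  let ?d = "\<lambda>n. \<Sum>j\<in>I. \<bar>apply_bcontfun (f n) j - apply_bcontfun g j\<bar>"
  have le: "norm (f n - g) \<le> ?d n" for n
  proof (rule norm_bound)
    fix j
    show "norm (apply_bcontfun (f n - g) j) \<le> ?d n"
    proof (cases "j \<in> I")
      case True
      then show ?thesis
        using member_le_sum[of j I "\<lambda>j. \<bar>apply_bcontfun (f n) j - apply_bcontfun g j\<bar>"] assms(1)
        by (simp add: minus_bcontfun.rep_eq)
    qed (simp add: minus_bcontfun.rep_eq assms(2) sum_nonneg)
  qed
  have "(\<lambda>n. \<bar>apply_bcontfun (f n) j - apply_bcontfun g j\<bar>) \<longlonglongrightarrow> 0" for j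
    using assms(3)[of j] by (simp add: LIM_zero tendsto_rabs_zero)
  then have "?d \<longlonglongrightarrow> (\<Sum>j\<in>I. 0)"
    by (intro tendsto_sum)
  then have "(\<lambda>n. norm (f n - g)) \<longlonglongrightarrow> 0"
    using le by (auto intro: Lim_null_comparison[of _ ?d])
  then show ?thesis
    by (simp add: LIM_zero_iff tendsto_norm_zero_iff)
qed

text \<open>Coordinate \<open>i\<close> of \<open>\<Gamma> s\<close> factors through a sequence
  supported in the finite set \<open>I i\<close>. There coordinatewise convergence already is norm
  convergence, so continuity of \<open>\<mu> i\<close> applies. The third claim is phrased
  coordinatewise because the limits of iterates taken later are only coordinatewise.\<close>

lemma gain_operator_props:
  assumes "gain_operator \<Gamma>"
  shows gain_operator_pos: "s \<in> linf_pos \<Longrightarrow> \<Gamma> s \<in> linf_pos"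
    and gain_operator_mono: "s \<in> linf_pos \<Longrightarrow> t \<in> linf_pos \<Longrightarrow> s \<preceq> t \<Longrightarrow> \<Gamma> s \<preceq> \<Gamma> t"
    and gain_operator_tendsto:
      "(\<And>n. x n \<in> linf_pos) \<Longrightarrow> s \<in> linf_pos \<Longrightarrow>
       (\<And>i. (\<lambda>n. apply_bcontfun (x n) i) \<longlonglongrightarrow> apply_bcontfun s i) \<Longrightarrow>
       (\<lambda>n. apply_bcontfun (\<Gamma> (x n)) i) \<longlonglongrightarrow> apply_bcontfun (\<Gamma> s) i"
proof -
  from assms obtain I :: "nat \<Rightarrow> nat set" and \<gamma> :: "nat \<Rightarrow> nat \<Rightarrow> real \<Rightarrow> real"
    and \<mu> :: "nat \<Rightarrow> linf \<Rightarrow> ennreal" where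
    I: "\<forall>i. finite (I i) \<and> i \<notin> I i"
    and \<gamma>: "\<forall>i j. \<gamma> i j \<in> class_K \<or> (\<forall>x\<ge>0. \<gamma> i j x = 0)"
      "\<forall>i j. j \<notin> I i \<longrightarrow> (\<forall>x\<ge>0. \<gamma> i j x = 0)"
    and \<mu>: "\<forall>i. MAF (\<mu> i)"
    and \<Gamma>: "\<forall>s\<in>linf_pos. \<Gamma> s \<in> linf_pos \<and>
      (\<forall>i. ennreal (apply_bcontfun (\<Gamma> s) i) =
        \<mu> i (Bcontfun (\<lambda>j. \<gamma> i j (apply_bcontfun s j))))"
    unfolding gain_operator_def by (elim exE conjE) (rule that)
  note fin = I[rule_format, THEN conjunct1] and maf = \<mu>[rule_format]
    and pos = \<Gamma>[rule_format, THEN conjunct1]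
    and eq = \<Gamma>[rule_format, THEN conjunct2, rule_format]
  have zero: "\<gamma> i j x = 0" if "j \<notin> I i" "0 \<le> x" for i j x
    using \<gamma>(2) that by blast
  show "\<Gamma> s \<in> linf_pos" if "s \<in> linf_pos" for s
    using pos that .
  define G where "G i s = Bcontfun (\<lambda>j. \<gamma> i j (apply_bcontfun s j))" for i s
  have nonneg: "0 \<le> \<gamma> i j x" if "0 \<le> x" for i j x
    using \<gamma>(1)[THEN spec, THEN spec, of i j] that by (auto simp: class_K_def)
  have mono: "\<gamma> i j x \<le> \<gamma> i j y" if "0 \<le> x" "x \<le> y" for i j x y
    using \<gamma>(1)[THEN spec, THEN spec, of i j] that by (auto simp: class_K_def dest!: strict_mono_on_leD[of _ _ x y])
  have cont: "continuous_on {0..} (\<gamma> i j)" for i j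
    using \<gamma>(1)[THEN spec, THEN spec, of i j]
    by (auto simp: class_K_def intro: continuous_on_eq[OF continuous_on_const[of _ 0]])
  \<comment> \<open>\<open>Bcontfun\<close> returns the intended sequence only for bounded
    functions; the finite support provides this.\<close>
  have apG: "apply_bcontfun (G i s) j = \<gamma> i j (apply_bcontfun s j)" if "s \<in> linf_pos" for i s j
    unfolding G_def using that
    by (subst Bcontfun_inverse)
       (auto simp: linf_pos_def zero intro: bcontfun_finite_support[OF fin[of i]])
  have G_on: "G i s \<in> linf_pos_on (I i)" if "s \<in> linf_pos" for i s
    using that by (auto simp: linf_pos_on_def linf_pos_def apG nonneg zero)
  have eqG: "ennreal (apply_bcontfun (\<Gamma> s) i) = \<mu> i (G i s)" if "s \<in> linf_pos" for s i
    using eq[OF that] by (simp add: G_def)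
  show "\<Gamma> s \<preceq> \<Gamma> t" if st: "s \<in> linf_pos" "t \<in> linf_pos" "s \<preceq> t" for s t
    unfolding linf_le_def
  proof
    fix i
    have "G i s \<preceq> G i t"
      using st by (auto simp: linf_le_def linf_pos_def apG intro: mono)
    moreover have "G i s \<in> linf_pos" "G i t \<in> linf_pos"
      using G_on st by (auto simp: linf_pos_on_def)
    ultimately have "\<mu> i (G i s) \<le> \<mu> i (G i t)"
      using maf[of i] unfolding MAF_def by blast
    then have "ennreal (apply_bcontfun (\<Gamma> s) i) \<le> ennreal (apply_bcontfun (\<Gamma> t) i)"
      using st by (simp add: eqG)
    then show "apply_bcontfun (\<Gamma> s) i \<le> apply_bcontfun (\<Gamma> t) i"
      using pos[OF st(2)] by (simp add: linf_pos_def)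
  qed
  show "(\<lambda>n. apply_bcontfun (\<Gamma> (x n)) i) \<longlonglongrightarrow> apply_bcontfun (\<Gamma> s) i"
    if x: "\<And>n. x n \<in> linf_pos" and s: "s \<in> linf_pos"
      and lim: "\<And>i. (\<lambda>n. apply_bcontfun (x n) i) \<longlonglongrightarrow> apply_bcontfun s i" for x s i
  proof -
    have "(\<lambda>n. G i (x n)) \<longlonglongrightarrow> G i s"
    proof (rule tendsto_linf_finite_support[OF fin[of i]])
      show "apply_bcontfun (G i (x n)) j = apply_bcontfun (G i s) j" if "j \<notin> I i" for n j
        using x[of n] s that by (simp add: apG zero linf_pos_def)
      show "(\<lambda>n. apply_bcontfun (G i (x n)) j) \<longlonglongrightarrow> apply_bcontfun (G i s) j" for j
        unfolding apG[OF x] apG[OF s]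
        by (rule continuous_on_tendsto_compose[OF cont lim])
           (use x s in \<open>auto simp: linf_pos_def\<close>)
    qed
    moreover have "continuous_on (linf_pos_on (I i)) (\<mu> i)"
      using maf[of i] fin[of i] unfolding MAF_def by blast
    ultimately have "(\<lambda>n. \<mu> i (G i (x n))) \<longlonglongrightarrow> \<mu> i (G i s)"
      using continuous_on_tendsto_compose[of "linf_pos_on (I i)" "\<mu> i" "\<lambda>n. G i (x n)" "G i s"]
        G_on[OF x] G_on[OF s] by simp
    then have "(\<lambda>n. ennreal (apply_bcontfun (\<Gamma> (x n)) i)) \<longlonglongrightarrow> ennreal (apply_bcontfun (\<Gamma> s) i)"
      using x s by (simp add: eqG)
    \<comment> \<open>\<open>ennreal\<close> collapses negative numbers to 0, so the passage back to
      real limits relies on the values of \<open>\<Gamma>\<close> being nonnegative.\<close>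
    then show ?thesis
      by (rule tendsto_ennrealD) (use pos x s in \<open>auto simp: linf_pos_def\<close>)
  qed
qed

section \<open>A priori bounds from the MBI property\<close>

locale mbi_gain =
  fixes \<Gamma> :: "linf \<Rightarrow> linf" and \<phi> :: "real \<Rightarrow> real"
  assumes gain: "gain_operator \<Gamma>" and mbi: "max_MBI \<Gamma> \<phi>"
begin

lemmas pos = gain_operator_pos[OF gain]
lemmas mono = gain_operator_mono[OF gain]
lemmas coord_tendsto = gain_operator_tendsto[OF gain]

lemma gain_r_pos: "s \<in> linf_pos \<Longrightarrow> gain_r \<Gamma> r s \<in> linf_pos"
  unfolding gain_r_def by (subst linf_max_commute) (intro linf_pos_max pos)

lemma gain_r_mono:
  "s \<in> linf_pos \<Longrightarrow> t \<in> linf_pos \<Longrightarrow> s \<preceq> t \<Longrightarrow> gain_r \<Gamma> r s \<preceq> gain_r \<Gamma> r t"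
  unfolding gain_r_def by (intro linf_max_mono linf_le_refl mono)

lemma gain_r_tendsto:
  assumes "\<And>n. x n \<in> linf_pos" and "s \<in> linf_pos"
    and "\<And>i. (\<lambda>n. apply_bcontfun (x n) i) \<longlonglongrightarrow> apply_bcontfun s i"
  shows "(\<lambda>n. apply_bcontfun (gain_r \<Gamma> r (x n)) i) \<longlonglongrightarrow> apply_bcontfun (gain_r \<Gamma> r s) i"
  unfolding gain_r_def apply_linf_max
  by (intro tendsto_max tendsto_const coord_tendsto assms)

text \<open>This is the MBI property for \<open>b = r *\<^sub>R ones\<close>, whose norm is
  \<open>r\<close>; it serves as the a priori bound for both iterations.\<close>

lemma subfixed_le:
  assumes "s \<in> linf_pos" and "0 \<le> r" and "s \<preceq> gain_r \<Gamma> r s"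
  shows "s \<preceq> \<phi> r *\<^sub>R ones"
proof -
  have "norm s \<le> \<phi> (norm (r *\<^sub>R ones))"
    using mbi assms scale_ones_pos[of r] unfolding max_MBI_def gain_r_def
    by (metis linf_max_commute)
  then show ?thesis
    using assms by (simp add: norm_scale_ones linf_pos_norm_le_iff del: norm_scaleR)
qed

text \<open>The constant sequence \<open>r *\<^sub>R ones\<close> lies below its image under
  \<open>gain_r \<Gamma> r\<close>, so the a priori bound applies to it.\<close>

lemma le_phi:
  assumes "0 \<le> r"
  shows "r \<le> \<phi> r"
proof -
  have "r *\<^sub>R ones \<preceq> \<phi> r *\<^sub>R ones"
    by (intro subfixed_le scale_ones_pos assms) (simp add: gain_r_def linf_max_ge)
  then show ?thesis
    by (simp add: linf_le_def)
qed

section \<open>The minimal fixed point, approached from below\<close>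

definition lower_iter :: "real \<Rightarrow> nat \<Rightarrow> linf" where
  "lower_iter r k = (gain_hat \<Gamma> ^^ k) (r *\<^sub>R ones)"

lemma lower_iter_simps [simp]:
  "lower_iter r 0 = r *\<^sub>R ones"
  "lower_iter r (Suc k) = lower_iter r k \<oplus> \<Gamma> (lower_iter r k)"
  by (simp_all add: lower_iter_def gain_hat_def)

lemma lower_iter_pos: "0 \<le> r \<Longrightarrow> lower_iter r k \<in> linf_pos"
  by (induction k) (auto simp: scale_ones_pos intro: linf_pos_max)

lemma lower_iter_ge: "r *\<^sub>R ones \<preceq> lower_iter r k"
  by (induction k) (simp_all add: linf_le_def apply_linf_max le_max_iff_disj)

text \<open>If s lies below its image under \<open>gain_r \<Gamma> r\<close>, then so does s
  \<oplus> \<Gamma> s: both of its parts are below \<open>gain_r \<Gamma> r s\<close>, which is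
  below the image of the larger point by monotonicity.\<close>

lemma lower_iter_subfixed:
  assumes "0 \<le> r"
  shows "lower_iter r k \<preceq> gain_r \<Gamma> r (lower_iter r k)"
proof (induction k)
  case 0
  show ?case
    by (simp add: gain_r_def linf_max_ge)
next
  case (Suc k)
  let ?s = "lower_iter r k"
  have "?s \<preceq> lower_iter r (Suc k)"
    by (simp add: linf_max_ge)
  then have "gain_r \<Gamma> r ?s \<preceq> gain_r \<Gamma> r (lower_iter r (Suc k))"
    by (intro gain_r_mono lower_iter_pos assms)
  moreover have "lower_iter r (Suc k) \<preceq> gain_r \<Gamma> r ?s"
    using Suc by (simp add: linf_max_le_iff) (simp add: gain_r_def linf_max_ge)
  ultimately show ?case
    using linf_le_trans by blast
qed

lemma lower_iter_le: "0 \<le> r \<Longrightarrow> lower_iter r k \<preceq> \<phi> r *\<^sub>R ones"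
  by (intro subfixed_le lower_iter_pos lower_iter_subfixed)

lemma bounded_lower_iter:
  assumes "0 \<le> r"
  shows "bounded (range (lower_iter r))"
  unfolding bounded_iff
  using linf_pos_norm_le_iff[OF lower_iter_pos[OF assms]] lower_iter_le[OF assms] by blast

lemma sigma_lower_eq: "sigma_lower \<Gamma> r = linf_Sup (lower_iter r)"
  by (simp add: sigma_lower_def lower_iter_def[abs_def])

lemma sigma_lower_tendsto:
  assumes "0 \<le> r"
  shows "(\<lambda>k. apply_bcontfun (lower_iter r k) i) \<longlonglongrightarrow> apply_bcontfun (sigma_lower \<Gamma> r) i"
proof -
  have "incseq (\<lambda>k. apply_bcontfun (lower_iter r k) i)"
    by (rule incseq_SucI) (simp add: apply_linf_max)
  then show ?thesis
    unfolding sigma_lower_eq apply_linf_Sup(2)[OF bounded_lower_iter[OF assms]]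
    by (intro LIMSEQ_incseq_SUP apply_linf_Sup(1) bounded_lower_iter assms)
qed

lemma sigma_lower_ge: "0 \<le> r \<Longrightarrow> r *\<^sub>R ones \<preceq> sigma_lower \<Gamma> r"
  unfolding linf_le_def
  by (auto intro!: LIMSEQ_le_const[OF sigma_lower_tendsto] lower_iter_ge[unfolded linf_le_def, rule_format, simplified])

lemma sigma_lower_pos: "0 \<le> r \<Longrightarrow> sigma_lower \<Gamma> r \<in> linf_pos"
  using linf_pos_mono scale_ones_pos sigma_lower_ge by blast

text \<open>Both inequalities come from coordinatewise limits along the iterates: one from
  \<open>lower_iter_subfixed\<close>, the other from the fact that \<Gamma> maps each iterate below
  the next one.\<close>

lemma sigma_lower_fixed:
  assumes r: "0 \<le> r"
  shows "gain_r \<Gamma> r (sigma_lower \<Gamma> r) = sigma_lower \<Gamma> r"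
proof (rule linf_le_antisym)
  let ?\<sigma> = "sigma_lower \<Gamma> r"
  note lims = sigma_lower_tendsto[OF r]
  show "?\<sigma> \<preceq> gain_r \<Gamma> r ?\<sigma>"
    unfolding linf_le_def
  proof
    fix i
    show "apply_bcontfun ?\<sigma> i \<le> apply_bcontfun (gain_r \<Gamma> r ?\<sigma>) i"
      by (rule LIMSEQ_le[OF lims gain_r_tendsto[OF lower_iter_pos[OF r] sigma_lower_pos[OF r] lims]])
         (use lower_iter_subfixed[OF r] in \<open>auto simp: linf_le_def\<close>)
  qed
  have "\<Gamma> ?\<sigma> \<preceq> ?\<sigma>"
    unfolding linf_le_def
  proof
    fix i
    show "apply_bcontfun (\<Gamma> ?\<sigma>) i \<le> apply_bcontfun ?\<sigma> i"
      by (rule LIMSEQ_le[OF coord_tendsto[OF lower_iter_pos[OF r] sigma_lower_pos[OF r] lims]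
            LIMSEQ_Suc[OF lims]]) (auto simp: apply_linf_max)
  qed
  then show "gain_r \<Gamma> r ?\<sigma> \<preceq> ?\<sigma>"
    using sigma_lower_ge[OF r] by (simp add: gain_r_def linf_max_le_iff)
qed

text \<open>The hypothesis puts both \<open>r *\<^sub>R ones\<close> and \<open>\<Gamma> s\<close>
  below \<open>s\<close>, so by induction no iterate can leave the region below
  \<open>s\<close>.\<close>

lemma sigma_lower_least:
  assumes r: "0 \<le> r" and s: "s \<in> linf_pos" and le: "gain_r \<Gamma> r s \<preceq> s"
  shows "sigma_lower \<Gamma> r \<preceq> s"
proof -
  have rs: "r *\<^sub>R ones \<preceq> s" and \<Gamma>s: "\<Gamma> s \<preceq> s"
    using le by (auto simp: gain_r_def linf_max_le_iff)
  have "lower_iter r k \<preceq> s" for k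
  proof (induction k)
    case (Suc k)
    then show ?case
      using linf_le_trans[OF mono[OF lower_iter_pos[OF r] s] \<Gamma>s]
      by (simp add: linf_max_le_iff)
  qed (simp add: rs)
  then show ?thesis
    unfolding linf_le_def by (auto intro!: LIMSEQ_le_const2[OF sigma_lower_tendsto[OF r]])
qed

section \<open>The maximal fixed point, approached from above\<close>

definition upper_iter :: "real \<Rightarrow> nat \<Rightarrow> linf" where
  "upper_iter r n = (gain_r \<Gamma> r ^^ n) (\<phi> r *\<^sub>R ones)"

lemma upper_iter_simps [simp]:
  "upper_iter r 0 = \<phi> r *\<^sub>R ones"
  "upper_iter r (Suc n) = gain_r \<Gamma> r (upper_iter r n)"
  by (simp_all add: upper_iter_def)

lemma upper_iter_pos: "0 \<le> r \<Longrightarrow> upper_iter r n \<in> linf_pos"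
  using le_phi[of r] by (induction n) (auto intro: scale_ones_pos gain_r_pos)

text \<open>Supplies a bound without any monotonicity in \<open>n\<close>: since
  \<open>r \<le> \<phi> r\<close>, the term \<open>r *\<^sub>R ones\<close> is absorbed by the
  dominating iterate at every step.\<close>

lemma upper_iter_le_lower_iter:
  assumes r: "0 \<le> r"
  shows "upper_iter r n \<preceq> lower_iter (\<phi> r) n"
proof (induction n)
  case (Suc n)
  have phi: "0 \<le> \<phi> r"
    using le_phi[OF r] r by simp
  have "r *\<^sub>R ones \<preceq> \<phi> r *\<^sub>R ones"
    using le_phi[OF r] by (simp add: linf_le_def)
  then have "r *\<^sub>R ones \<preceq> lower_iter (\<phi> r) n"
    using lower_iter_ge linf_le_trans by blast
  moreover have "\<Gamma> (upper_iter r n) \<preceq> \<Gamma> (lower_iter (\<phi> r) n)"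
    using Suc by (intro mono upper_iter_pos lower_iter_pos r phi)
  ultimately show ?case
    by (simp add: gain_r_def linf_max_mono)
qed (simp add: linf_le_refl)

lemma upper_iter_le: "0 \<le> r \<Longrightarrow> upper_iter r n \<preceq> \<phi> (\<phi> r) *\<^sub>R ones"
  using upper_iter_le_lower_iter lower_iter_le le_phi linf_le_trans order_trans by metis

text \<open>The a priori bound puts \<open>s\<close> below the starting point; applying the monotone
  map preserves this, as \<open>s\<close> is below its own image.\<close>

lemma subfixed_le_upper_iter:
  assumes r: "0 \<le> r" and s: "s \<in> linf_pos" and le: "s \<preceq> gain_r \<Gamma> r s"
  shows "s \<preceq> upper_iter r n"
proof (induction n)
  case 0
  show ?case
    using subfixed_le[OF s r le] by simp
next
  case (Suc n)
  then show ?case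
    using linf_le_trans[OF le gain_r_mono[OF s upper_iter_pos[OF r]]] by simp
qed

lemma sigma_upper_eq: "sigma_upper \<Gamma> \<phi> r = linf_Inf (upper_iter r)"
  by (simp add: sigma_upper_def upper_iter_def[abs_def])

lemma sigma_upper_le: "0 \<le> r \<Longrightarrow> sigma_upper \<Gamma> \<phi> r \<preceq> upper_iter r n"
  unfolding linf_le_def sigma_upper_eq
  by (auto simp: apply_linf_Inf(2)[OF upper_iter_pos]
      intro!: cINF_lower apply_linf_Inf(1)[OF upper_iter_pos])

lemma le_sigma_upper: "0 \<le> r \<Longrightarrow> (\<And>n. s \<preceq> upper_iter r n) \<Longrightarrow> s \<preceq> sigma_upper \<Gamma> \<phi> r"
  unfolding linf_le_def sigma_upper_eq
  by (auto simp: apply_linf_Inf(2)[OF upper_iter_pos] intro!: cINF_greatest)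

lemma sigma_upper_pos:
  assumes "0 \<le> r"
  shows "sigma_upper \<Gamma> \<phi> r \<in> linf_pos"
proof -
  have "0 \<preceq> sigma_upper \<Gamma> \<phi> r"
    by (rule le_sigma_upper[OF assms])
       (use upper_iter_pos[OF assms] in \<open>auto simp: linf_le_def linf_pos_def\<close>)
  then show ?thesis
    by (simp add: linf_le_def linf_pos_def)
qed

lemma sigma_upper_greatest:
  assumes "0 \<le> r" and "s \<in> linf_pos" and "s \<preceq> gain_r \<Gamma> r s"
  shows "s \<preceq> sigma_upper \<Gamma> \<phi> r"
  using assms by (intro le_sigma_upper subfixed_le_upper_iter)

lemma sigma_upper_tendsto:
  assumes r: "0 \<le> r"
  shows "(\<lambda>n. apply_bcontfun (upper_iter r n) i) \<longlonglongrightarrow> apply_bcontfun (sigma_upper \<Gamma> \<phi> r) i"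
proof -
  \<comment> \<open>The tail suprema of the iterates decrease, and their infimum \<open>Y\<close> is
    the coordinatewise limes superior.\<close>
  define y where "y n = linf_Sup (\<lambda>m. upper_iter r (n + m))" for n
  define Y where "Y = linf_Inf y"
  have "norm (upper_iter r n) \<le> \<phi> (\<phi> r)" for n
    using upper_iter_le[OF r] linf_pos_norm_le_iff[OF upper_iter_pos[OF r]] by blast
  then have bdd: "bounded (range (\<lambda>m. upper_iter r (n + m)))" for n
    unfolding bounded_iff by blast
  note ap = apply_linf_Sup[OF bdd, folded y_def]
  have ge: "upper_iter r (n + m) \<preceq> y n" for n m
    unfolding linf_le_def by (auto simp: ap(2) intro!: cSUP_upper ap(1))
  have least: "y n \<preceq> t" if "\<And>m. upper_iter r (n + m) \<preceq> t" for n t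
    using that unfolding linf_le_def by (auto simp: ap(2) intro!: cSUP_least)
  have y_pos: "y n \<in> linf_pos" for n
    using linf_pos_mono[OF upper_iter_pos[OF r] ge[of n 0]] .
  have apY: "bdd_below (range (\<lambda>n. apply_bcontfun (y n) j))"
    "apply_bcontfun Y j = (INF n. apply_bcontfun (y n) j)" for j
    unfolding Y_def by (rule apply_linf_Inf[OF y_pos])+
  have y_dec: "y (Suc n) \<preceq> y n" for n
    by (rule least) (use ge[of n "Suc m" for m] in simp)
  have y_lim: "(\<lambda>n. apply_bcontfun (y n) j) \<longlonglongrightarrow> apply_bcontfun Y j" for j
    unfolding apY(2)
    by (intro LIMSEQ_decseq_INF apY(1) decseq_SucI) (use y_dec in \<open>auto simp: linf_le_def\<close>)
  have Y_pos: "Y \<in> linf_pos"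
    unfolding linf_pos_def
    by (auto intro!: LIMSEQ_le_const[OF y_lim] y_pos[unfolded linf_pos_def, simplified, rule_format])
  \<comment> \<open>Every iterate from index \<open>Suc n\<close> on is the image of one from index
    \<open>n\<close> on, hence of a point below \<open>y n\<close>; so the right-hand side bounds
    the shorter tail.\<close>
  have y_step: "y (Suc n) \<preceq> gain_r \<Gamma> r (y n)" for n
    by (rule least) (use gain_r_mono[OF upper_iter_pos[OF r] y_pos ge] in simp)
  have "Y \<preceq> gain_r \<Gamma> r Y"
    unfolding linf_le_def
  proof
    fix j
    show "apply_bcontfun Y j \<le> apply_bcontfun (gain_r \<Gamma> r Y) j"
      by (rule LIMSEQ_le[OF LIMSEQ_Suc[OF y_lim] gain_r_tendsto[OF y_pos Y_pos y_lim]])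
         (use y_step in \<open>auto simp: linf_le_def\<close>)
  qed
  then have "Y \<preceq> sigma_upper \<Gamma> \<phi> r"
    by (rule sigma_upper_greatest[OF r Y_pos])
  \<comment> \<open>Each \<open>y n\<close> dominates the iterate with index \<open>n\<close>, hence
    also the infimum of all iterates.\<close>
  moreover have "sigma_upper \<Gamma> \<phi> r \<preceq> Y"
    unfolding linf_le_def
  proof
    fix j
    show "apply_bcontfun (sigma_upper \<Gamma> \<phi> r) j \<le> apply_bcontfun Y j"
      by (rule LIMSEQ_le_const[OF y_lim])
         (use linf_le_trans[OF sigma_upper_le[OF r] ge[of _ 0]] in \<open>auto simp: linf_le_def\<close>)
  qed
  ultimately have Y: "Y = sigma_upper \<Gamma> \<phi> r"
    by (rule linf_le_antisym)
  show ?thesis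
  \<comment> \<open>The iterates are squeezed between their infimum and the tail suprema, which now
    have the same limit.\<close>
  proof (rule tendsto_sandwich[OF _ _ tendsto_const y_lim[unfolded Y]])
    show "\<forall>\<^sub>F n in sequentially. apply_bcontfun (sigma_upper \<Gamma> \<phi> r) i \<le> apply_bcontfun (upper_iter r n) i"
      using sigma_upper_le[OF r] by (simp add: linf_le_def)
    show "\<forall>\<^sub>F n in sequentially. apply_bcontfun (upper_iter r n) i \<le> apply_bcontfun (y n) i"
      using ge[of _ 0] by (simp add: linf_le_def)
  qed
qed

text \<open>The shifted iterates converge coordinatewise to \<open>sigma_upper\<close> and, by
  continuity, to its image; limits are unique.\<close>

lemma sigma_upper_fixed:
  assumes r: "0 \<le> r"
  shows "gain_r \<Gamma> r (sigma_upper \<Gamma> \<phi> r) = sigma_upper \<Gamma> \<phi> r"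
proof (rule bcontfun_eqI)
  fix i
  have "(\<lambda>n. apply_bcontfun (upper_iter r (Suc n)) i) \<longlonglongrightarrow>
      apply_bcontfun (gain_r \<Gamma> r (sigma_upper \<Gamma> \<phi> r)) i"
    unfolding upper_iter_simps
    by (intro gain_r_tendsto upper_iter_pos sigma_upper_pos sigma_upper_tendsto r)
  then show "apply_bcontfun (gain_r \<Gamma> r (sigma_upper \<Gamma> \<phi> r)) i = apply_bcontfun (sigma_upper \<Gamma> \<phi> r) i"
    using LIMSEQ_unique LIMSEQ_Suc[OF sigma_upper_tendsto[OF r]] by blast
qed

text \<open>A monotone map that fixes both endpoints maps the interval between them into
  itself.\<close>

lemma order_interval_invariant:
  assumes "0 \<le> r"
  shows "gain_r \<Gamma> r ` order_interval (sigma_lower \<Gamma> r) (sigma_upper \<Gamma> \<phi> r)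
    \<subseteq> order_interval (sigma_lower \<Gamma> r) (sigma_upper \<Gamma> \<phi> r)"
  using gain_r_pos gain_r_mono[OF sigma_lower_pos[OF assms], of _ r]
    gain_r_mono[OF _ sigma_upper_pos[OF assms], of _ r]
  by (auto simp: order_interval_def sigma_lower_fixed[OF assms] sigma_upper_fixed[OF assms])

lemma fixed_point_between:
  assumes "0 \<le> r" and "s \<in> linf_pos" and "gain_r \<Gamma> r s = s"
  shows "sigma_lower \<Gamma> r \<preceq> s \<and> s \<preceq> sigma_upper \<Gamma> \<phi> r"
  using assms sigma_lower_least sigma_upper_greatest by (simp add: linf_le_refl)

end

theorem proposition5p5:
  fixes \<Gamma> :: "linf \<Rightarrow> linf" and \<phi> :: "real \<Rightarrow> real" and r :: real
  assumes "gain_operator \<Gamma>"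
    and "\<phi> \<in> class_K_inf"
    and "max_MBI \<Gamma> \<phi>"
    and "r > 0"
  shows "bounded (range (\<lambda>k. (gain_hat \<Gamma> ^^ k) (r *\<^sub>R ones)))
    \<and> sigma_lower \<Gamma> r \<in> linf_pos
    \<and> gain_r \<Gamma> r (sigma_lower \<Gamma> r) = sigma_lower \<Gamma> r
    \<and> sigma_upper \<Gamma> \<phi> r \<in> linf_pos
    \<and> gain_r \<Gamma> r (sigma_upper \<Gamma> \<phi> r) = sigma_upper \<Gamma> \<phi> r
    \<and> (\<forall>s\<in>linf_pos. gain_r \<Gamma> r s = s \<longrightarrow>
          sigma_lower \<Gamma> r \<preceq> s \<and> s \<preceq> sigma_upper \<Gamma> \<phi> r)
    \<and> gain_r \<Gamma> r ` order_interval (sigma_lower \<Gamma> r) (sigma_upper \<Gamma> \<phi> r)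
        \<subseteq> order_interval (sigma_lower \<Gamma> r) (sigma_upper \<Gamma> \<phi> r)
    \<and> {s \<in> linf_pos. gain_r \<Gamma> r s = s}
        \<subseteq> order_interval (sigma_lower \<Gamma> r) (sigma_upper \<Gamma> \<phi> r)"
proof -
  interpret mbi_gain \<Gamma> \<phi>
    using assms by unfold_locales
  have r: "0 \<le> r"
    using assms by simp
  show ?thesis
    using bounded_lower_iter[OF r, unfolded lower_iter_def[abs_def]] fixed_point_between[OF r]
    by (intro conjI ballI impI sigma_lower_pos sigma_lower_fixed sigma_upper_pos
        sigma_upper_fixed order_interval_invariant r)
       (auto simp only: order_interval_def mem_Collect_eq)
qed

end
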